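(* Denote by $(n_j)$ the sequence of consecutive deficient numbers. Then, for any $K\geq 1$, $$\limsup_{j\to\infty}\inf_{0\leq k\leq K}(n_{j+k+1}-n_{j+k})=\infty.$$
   Context: $\mathbb{N}=\{1,2,\dots\}$. For $n\in\mathbb{N}$ let $s(n):=\sum_{d\mid n,\,d<n}d$ (sum of proper positive divisors). $n\in\mathbb{N}$ is deficient if $s(n)<n$. The sequence $(n_j)_{j\ge1}$ enumerates the deficient numbers in increasing order. *)

theory Defs
  imports Complex_Main "HOL-Library.Infinite_Set" "HOL-Library.Extended_Real"
    "HOL-Library.Liminf_Limsup" "HOL-Computational_Algebra.Primes"
begin

definition aliquot_sum :: "nat \<Rightarrow> nat" where
  "aliquot_sum n = (\<Sum>d | d dvd n \<and> d < n. d)"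

definition deficient :: "nat \<Rightarrow> bool" where
  "deficient n \<longleftrightarrow> n \<ge> 1 \<and> aliquot_sum n < n"

text \<open>The increasing enumeration \<open>n\<^sub>1 < n\<^sub>2 < \<dots>\<close> of the deficient numbers. The library function
  \<open>enumerate\<close> is indexed from \<open>0\<close>, hence the shift; the value at index \<open>0\<close> is a junk value.\<close>

definition deficient_seq :: "nat \<Rightarrow> nat" where
  "deficient_seq j = enumerate {n. deficient n} (j - 1)"

text \<open>\<open>enumerate\<close> is only meaningful here because there are infinitely many deficient numbers:\<close>

lemma deficient_prime:
  assumes "prime p"
  shows "deficient p"
proof -
  have "{d. d dvd p \<and> d < p} = {1}"
    using assms prime_gt_1_nat[OF assms] by (auto simp: prime_nat_iff)
  then have "aliquot_sum p = 1"
    by (simp add: aliquot_sum_def)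
  then show ?thesis
    using prime_gt_1_nat[OF assms] by (simp add: deficient_def)
qed

lemma infinite_deficient: "infinite {n. deficient n}"
proof -
  have "{p::nat. prime p} \<subseteq> {n. deficient n}"
    using deficient_prime by blast
  then show ?thesis
    using primes_infinite finite_subset by blast
qed

lemma strict_mono_on_deficient_seq: "strict_mono_on {1..} deficient_seq"
  by (auto intro!: strict_mono_onI enumerate_mono simp: deficient_seq_def infinite_deficient)

lemma deficient_seq_image: "deficient_seq ` {1..} = {n. deficient n}"
proof -
  have "(\<lambda>j. j - 1) ` {1..} = (UNIV :: nat set)"
    by (auto simp: image_iff intro!: bexI[of _ "Suc _"])
  then have "deficient_seq ` {1..} = range (enumerate {n. deficient n})"
    unfolding deficient_seq_def by (metis image_image)
  then show ?thesis
    using range_enumerate[OF infinite_deficient] by simp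
qed

end

theory Submission
  imports Defs "HOL-Number_Theory.Cong" "HOL-Analysis.Summation_Tests"
begin

text \<open>Given \<open>M\<close>, there are \<open>K + 2\<close> consecutive deficient numbers in arithmetic progression whose
  common difference \<open>P\<close> is at least \<open>M\<close>. Write \<open>s n\<close> for the aliquot sum; the quantity to control is
  \<open>s n / n\<close>, the sum of \<open>1 / d\<close> over the divisors \<open>d > 1\<close> of \<open>n\<close>.

  Let \<open>P = z!\<close> with \<open>z\<close> large in terms of \<open>K\<close> and \<open>M\<close>, and consider a window starting at \<open>x\<close> of length
  \<open>L = (K + 1) P\<close>. The offsets \<open>a\<close> that are multiples of \<open>P\<close> are to carry deficient numbers, all other
  offsets \<open>b\<close> nondeficient ones.

  The second requirement is a system of congruences. The harmonic series diverges along the residue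
  class of 1 modulo any \<open>N\<close>, so there are nondeficient numbers coprime to \<open>N\<close>
  (\<open>exists_not_deficient_coprime\<close>). Hence each \<open>b\<close> can be given a nondeficient \<open>q\<^sub>b\<close>, these being
  pairwise coprime and coprime to \<open>L!\<close>. Nondeficiency passes to multiples, so it suffices that
  \<open>q\<^sub>b\<close> divides \<open>x + b\<close>. The Chinese remainder theorem solves these congruences together with
  \<open>x \<equiv> 1\<close> modulo \<open>P\<close>, and the solutions contain a residue class \<open>x = r + Q t\<close>, where \<open>Q\<close> is the product
  of all the moduli (\<open>exists_residue_class_pattern\<close>). Moreover each \<open>r + a\<close> is coprime to \<open>Q\<close>: it is
  1 modulo \<open>P\<close>, and a common factor of \<open>x + a\<close> and \<open>q\<^sub>b\<close> would divide \<open>\<bar>a - b\<bar>\<close> and hence \<open>L!\<close>.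

  The first requirement is met on average over \<open>t\<close>. The numbers \<open>r + a + Q t\<close> have no divisor \<open>d\<close> with
  \<open>1 < d \<le> z\<close>, and any other \<open>d\<close> divides at most about one in \<open>d\<close> of them, so the mean of \<open>s n / n\<close> over
  them is, up to a vanishing error, at most \<open>\<Sum>\<^bsub>d > z\<^esub> 1 / d\<^sup>2 \<le> 1 / z\<close>. With only \<open>K + 2\<close> offsets \<open>a\<close>, some \<open>t\<close> makes
  \<open>s n / n < 1\<close> hold at all of them simultaneously (\<open>exists_simultaneously_deficient\<close>).\<close>

section \<open>Reciprocal sums over divisors\<close>

text \<open>For \<open>n \<ge> 1\<close> this is \<open>aliquot_sum n / n\<close>, rewritten with the complementary divisors \<open>n div d\<close>. In this
  form it is visibly monotone under divisibility, and it can be averaged over \<open>n\<close> by exchanging sums.\<close>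

definition aliquot_ratio :: "nat \<Rightarrow> real" where
  "aliquot_ratio n = (\<Sum>d | d dvd n \<and> 1 < d. 1 / real d)"

lemma aliquot_sum_eq_ratio:
  assumes "n \<ge> 1"
  shows "real (aliquot_sum n) = real n * aliquot_ratio n"
proof -
  have "real (aliquot_sum n) = (\<Sum>d | d dvd n \<and> d < n. real d)"
    by (simp add: aliquot_sum_def)
  also have "\<dots> = (\<Sum>d | d dvd n \<and> 1 < d. real (n div d))"
  proof (rule sum.reindex_bij_witness[where i = "\<lambda>d. n div d" and j = "\<lambda>d. n div d"])
    fix d assume "d \<in> {d. d dvd n \<and> d < n}"
    then obtain e where e: "n = d * e" "d < n" by auto
    have "d > 0" using e by (cases d) auto
    moreover have "e > 1"
    proof (rule ccontr)
      assume "\<not> e > 1"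
      then have "e = 0 \<or> e = 1" by auto
      then show False using e by auto
    qed
    ultimately show "n div (n div d) = d" "n div d \<in> {d. d dvd n \<and> 1 < d}"
      using e by auto
    then show "real (n div (n div d)) = real d" by simp
  next
    fix d assume "d \<in> {d. d dvd n \<and> 1 < d}"
    then obtain e where "n = d * e" "1 < d" by auto
    then show "n div (n div d) = d" "n div d \<in> {d. d dvd n \<and> d < n}"
      using assms by auto
  qed
  also have "\<dots> = (\<Sum>d | d dvd n \<and> 1 < d. real n * (1 / real d))"
    by (intro sum.cong) (auto simp: real_of_nat_div)
  finally show ?thesis
    by (simp add: aliquot_ratio_def sum_distrib_left)
qed

lemma deficient_iff_aliquot_ratio:
  assumes "n \<ge> 1"
  shows "deficient n \<longleftrightarrow> aliquot_ratio n < 1"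
proof -
  have "deficient n \<longleftrightarrow> real (aliquot_sum n) < real n"
    using assms by (simp add: deficient_def)
  also have "\<dots> \<longleftrightarrow> real n * aliquot_ratio n < real n * 1"
    using assms by (simp add: aliquot_sum_eq_ratio)
  also have "\<dots> \<longleftrightarrow> aliquot_ratio n < 1"
    using assms by (subst mult_less_cancel_left_pos) auto
  finally show ?thesis .
qed

lemma sum_inverse_le_aliquot_ratio:
  assumes "n \<ge> 1" and "\<And>d. d \<in> D \<Longrightarrow> d dvd n \<and> 1 < d"
  shows "(\<Sum>d\<in>D. 1 / real d) \<le> aliquot_ratio n"
  unfolding aliquot_ratio_def using assms by (intro sum_mono2) auto

lemma not_deficient_multiple:
  assumes "q dvd n" and "n \<ge> 1" and "\<not> deficient q"
  shows "\<not> deficient n"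
proof -
  have q: "q \<ge> 1"
    using assms by (auto intro: Suc_leI dvd_pos_nat)
  have "aliquot_ratio q \<le> aliquot_ratio n"
    unfolding aliquot_ratio_def[of q] using assms
    by (intro sum_inverse_le_aliquot_ratio) (auto intro: dvd_trans)
  then show ?thesis
    using assms q by (simp add: deficient_iff_aliquot_ratio)
qed

section \<open>Nondeficient numbers with prescribed coprimality\<close>

text \<open>The numbers \<open>1 + N k\<close> with \<open>k \<ge> 1\<close> are coprime to \<open>N\<close>, and the sum of their reciprocals diverges by
  comparison with the harmonic series. Once a finite part of this sum exceeds 1, the product of the
  numbers involved has all of them among its divisors and is therefore not deficient.\<close>

lemma exists_not_deficient_coprime:
  fixes N :: nat
  assumes "N > 0"
  shows "\<exists>q\<ge>1. coprime q N \<and> \<not> deficient q"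
proof -
  define g where "g k = 1 + N * Suc k" for k
  have "\<not> summable (\<lambda>k. 1 / real (g k))"
  proof
    assume "summable (\<lambda>k. 1 / real (g k))"
    then have "summable (\<lambda>k. 2 * real N * (1 / real (g k)))"
      by (rule summable_mult)
    then have "summable (\<lambda>k. inverse (real (Suc k)))"
    proof (rule summable_comparison_test')
      fix k :: nat
      have "1 \<le> N * Suc k" using assms by simp
      then have "real (g k) \<le> real (2 * N * Suc k)"
        unfolding g_def of_nat_le_iff by linarith
      then have "real (g k) \<le> 2 * real N * real (Suc k)"
        by (simp only: of_nat_mult of_nat_numeral)
      moreover have "g k > 0" by (simp add: g_def)
      then have "real (g k) > 0" by (simp only: of_nat_0_less_iff)
      ultimately show "norm (inverse (real (Suc k))) \<le> 2 * real N * (1 / real (g k))"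
        by (simp add: field_simps del: of_nat_Suc)
    qed
    then show False
      using not_summable_harmonic[where ?'a = real]
        summable_Suc_iff[of "\<lambda>n. inverse (real n)"] by simp
  qed
  then obtain n where n: "(\<Sum>k<n. 1 / real (g k)) > 1"
    by (metis summableI_nonneg_bounded[of "\<lambda>k. 1 / real (g k)" 1] not_le of_nat_0_le_iff
        divide_nonneg_nonneg zero_le_one)
  define q where "q = (\<Prod>k<n. g k)"
  have "q \<ge> 1"
    unfolding q_def by (rule prod_ge_1) (simp add: g_def)
  moreover have "coprime (g k) N" for k
  proof (rule coprimeI)
    fix c assume "c dvd g k" "c dvd N"
    then show "is_unit c"
      using dvd_add_left_iff[of c "N * Suc k" 1] by (simp only: g_def dvd_mult2)
  qed
  then have "coprime q N"
    unfolding q_def by (intro prod_coprime_left)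
  moreover have "\<not> deficient q"
  proof -
    have "inj g" using assms by (auto simp: g_def inj_on_def)
    then have "(\<Sum>k<n. 1 / real (g k)) = (\<Sum>d\<in>g ` {..<n}. 1 / real d)"
      by (subst sum.reindex) (auto simp: inj_on_def)
    also have "\<dots> \<le> aliquot_ratio q"
    proof (rule sum_inverse_le_aliquot_ratio[OF \<open>q \<ge> 1\<close>])
      fix d assume "d \<in> g ` {..<n}"
      then show "d dvd q \<and> 1 < d"
        using assms by (auto simp: q_def g_def intro: dvd_prodI)
    qed
    finally show ?thesis
      using n \<open>q \<ge> 1\<close> by (simp add: deficient_iff_aliquot_ratio)
  qed
  ultimately show ?thesis by blast
qed

lemma exists_coprime_not_deficient_family:
  fixes N k :: nat
  assumes "N > 0"
  shows "\<exists>q. (\<forall>i<k. q i \<ge> 1 \<and> coprime (q i) N \<and> \<not> deficient (q i)) \<and>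
             (\<forall>i<k. \<forall>j<k. i \<noteq> j \<longrightarrow> coprime (q i) (q j))"
proof (induction k)
  case 0
  show ?case by simp
next
  case (Suc k)
  then obtain q where q: "\<And>i. i < k \<Longrightarrow> q i \<ge> 1 \<and> coprime (q i) N \<and> \<not> deficient (q i)"
    "\<And>i j. i < k \<Longrightarrow> j < k \<Longrightarrow> i \<noteq> j \<Longrightarrow> coprime (q i) (q j)" by blast
  have "0 < N * (\<Prod>i<k. q i)"
    using assms q(1) by (fastforce intro!: prod_pos)
  from exists_not_deficient_coprime[OF this]
  obtain p where p: "p \<ge> 1" "coprime p N" "coprime p (\<Prod>i<k. q i)" "\<not> deficient p"
    by auto
  then have "coprime p (q i)" if "i < k" for i
    using that by (meson coprime_divisors dvd_prodI dvd_refl finite_lessThan lessThan_iff)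
  then show ?case
    using p q by (intro exI[of _ "q(k := p)"]) (auto simp: less_Suc_eq coprime_commute)
qed

text \<open>The offsets divisible by \<open>P\<close> are those meant to carry deficient numbers. Coprimality to the modulus
  keeps small divisors away from them throughout the progression, while every other offset is forced
  to be nondeficient throughout.\<close>

lemma exists_residue_class_pattern:
  fixes P L X :: nat
  assumes "P > 0" and "P \<le> L"
  shows "\<exists>r Q. r \<ge> X \<and> r \<ge> 1 \<and> Q > 0 \<and> P dvd Q \<and>
    (\<forall>a\<le>L. P dvd a \<longrightarrow> coprime (r + a) Q) \<and>
    (\<forall>b<L. \<forall>t. \<not> P dvd b \<longrightarrow> \<not> deficient (r + b + Q * t))"
proof -
  obtain q where q: "\<And>i. i < L \<Longrightarrow> q i \<ge> 1" "\<And>i. i < L \<Longrightarrow> coprime (q i) (fact L)"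
    "\<And>i. i < L \<Longrightarrow> \<not> deficient (q i)"
    "\<And>i j. i < L \<Longrightarrow> j < L \<Longrightarrow> i \<noteq> j \<Longrightarrow> coprime (q i) (q j)"
    using exists_coprime_not_deficient_family[of "fact L" L] by auto
  define B where "B = {b. b < L \<and> \<not> P dvd b}"
  have B: "finite B" "0 \<notin> B" "\<And>b. b \<in> B \<Longrightarrow> b < L" "\<And>b. b \<in> B \<Longrightarrow> \<not> P dvd b"
    by (auto simp: B_def)
  \<comment> \<open>Offset 0 is a multiple of \<open>P\<close> and needs no congruence of its own, so index 0 is free for \<open>P\<close>.\<close>
  define m where "m = (\<lambda>b. if b = 0 then P else q b)"
  \<comment> \<open>A nonnegative representative of the class of \<open>-b\<close> modulo \<open>q b\<close>.\<close>
  define u where "u = (\<lambda>b. if b = 0 then 1 else q b * b - b)"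
  define Q where "Q = (\<Prod>b\<in>insert 0 B. m b)"
  have "P dvd fact L"
    using assms by (simp add: dvd_fact)
  then have qP: "coprime (q b) P" if "b < L" for b
    using q(2)[OF that] by (meson coprime_divisors dvd_refl)
  have "\<forall>i\<in>insert 0 B. \<forall>j\<in>insert 0 B. i \<noteq> j \<longrightarrow> coprime (m i) (m j)"
    using B qP q(4) by (auto simp: m_def coprime_commute)
  from chinese_remainder_nat[OF _ this, of u] B
  obtain r0 where r0: "\<And>i. i \<in> insert 0 B \<Longrightarrow> [r0 = u i] (mod m i)" by auto
  have Qpos: "Q > 0"
    unfolding Q_def using B q(1) assms by (fastforce simp: m_def intro!: prod_pos)
  \<comment> \<open>Adding a positive multiple of \<open>Q\<close> moves the solution beyond \<open>X\<close>.\<close>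
  define r where "r = r0 + Q * Suc X"
  have mQ: "m i dvd Q" if "i \<in> insert 0 B" for i
    unfolding Q_def using B that by (intro dvd_prodI) auto
  have "Suc X \<le> Q * Suc X" using Qpos by (cases Q) auto
  then have rX: "r \<ge> X" "r \<ge> 1" by (auto simp: r_def)
  have r: "[r = u i] (mod m i)" if "i \<in> insert 0 B" for i
    using r0[OF that] mQ[OF that] unfolding r_def
    by (metis cong_add_lcancel_0_nat cong_mult_self_left cong_sym cong_trans dvdE mult.assoc)
  have rP: "[r = 1] (mod P)"
    using r[of 0] by (simp add: m_def u_def)
  have rb: "q b dvd r + b" if "b \<in> B" for b
  proof -
    have "b \<noteq> 0" "q b \<ge> 1" using that B(2) q(1)[OF B(3)] by metis+
    then have "[r + b = (q b * b - b) + b] (mod q b)"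
      using r[of b] that by (intro cong_add) (auto simp: m_def u_def)
    moreover have "(q b * b - b) + b = q b * b"
      using \<open>q b \<ge> 1\<close> by (simp add: le_add_diff_inverse2)
    ultimately show ?thesis
      by (simp add: cong_dvd_iff)
  qed
  have cop: "coprime (r + a) Q" if a: "a \<le> L" "P dvd a" for a
  proof -
    have "coprime (r + a) (m b)" if "b \<in> insert 0 B" for b
    proof (cases "b = 0")
      case True
      have "[r + a = 1 + 0] (mod P)"
        using rP a by (intro cong_add) (auto simp: cong_0_iff)
      then have "coprime (r + a) P"
        using cong_imp_coprime[OF cong_sym] by force
      then show ?thesis
        using True by (simp add: m_def)
    next
      case False
      then have bB: "b \<in> B" using that by auto
      have "a \<noteq> b" using bB B(4) a by auto
      show ?thesis
      proof (rule coprimeI)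
        fix c assume c: "c dvd r + a" "c dvd m b"
        then have cq: "c dvd q b" using False by (simp add: m_def)
        then have "c dvd r + b" using rb[OF bB] by (rule dvd_trans)
        \<comment> \<open>A common divisor divides the distance of the two positions, hence the factorial.\<close>
        with c(1) have "c dvd (r + a) - (r + b)" "c dvd (r + b) - (r + a)"
          by (simp_all only: dvd_diff_nat)
        then have "c dvd a - b" "c dvd b - a" by simp_all
        then have "c dvd fact L"
        proof (cases "a < b")
          case True
          then have "b - a dvd fact L" using B(3)[OF bB] by (intro dvd_fact) auto
          with \<open>c dvd b - a\<close> show ?thesis by (rule dvd_trans)
        next
          case False
          then have "a - b dvd fact L" using \<open>a \<noteq> b\<close> a by (intro dvd_fact) auto
          with \<open>c dvd a - b\<close> show ?thesis by (rule dvd_trans)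
        qed
        with cq q(2)[OF B(3)[OF bB]] show "is_unit c"
          by (meson coprime_common_divisor)
      qed
    qed
    then show ?thesis
      unfolding Q_def by (intro prod_coprime_right)
  qed
  have "\<not> deficient (r + b + Q * t)" if "b < L" "\<not> P dvd b" for b t
  proof (rule not_deficient_multiple)
    have bB: "b \<in> B" using that by (simp add: B_def)
    have "q b dvd Q" using mQ[of b] bB B by (auto simp: m_def split: if_splits)
    then show "q b dvd r + b + Q * t"
      using rb[OF bB] by auto
    show "\<not> deficient (q b)" using q(3) that by simp
    show "1 \<le> r + b + Q * t" using rX by simp
  qed
  then show ?thesis
    using rX Qpos cop mQ[of 0] by (intro exI[of _ r] exI[of _ Q]) (auto simp: m_def)
qed

section \<open>Averaging over an arithmetic progression\<close>

text \<open>The indices counted lie in a single residue class modulo \<open>d\<close>, so each block of \<open>d\<close> consecutive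
  indices contains at most one of them.\<close>

lemma card_dvd_progression_le:
  fixes d Q c T :: nat
  assumes "coprime d Q" and "d > 0"
  shows "card {t. t < T \<and> d dvd c + Q * t} \<le> T div d + 1"
proof -
  have "inj_on (\<lambda>t. t div d) {t. t < T \<and> d dvd c + Q * t}"
  proof (rule inj_onI)
    fix s t assume st: "s \<in> {t. t < T \<and> d dvd c + Q * t}"
      "t \<in> {t. t < T \<and> d dvd c + Q * t}" "s div d = t div d"
    then have "[c + Q * s = c + Q * t] (mod d)"
      by (simp add: cong_def mod_eq_0_iff_dvd[symmetric])
    then have "[s = t] (mod d)"
      using assms by (metis cong_add_lcancel_nat cong_mult_lcancel_nat coprime_commute)
    then show "s = t"
      using st(3) by (metis cong_def div_mult_mod_eq)
  qed
  moreover have "(\<lambda>t. t div d) ` {t. t < T \<and> d dvd c + Q * t} \<subseteq> {..T div d}"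
    by (auto intro: div_le_mono)
  ultimately have "card {t. t < T \<and> d dvd c + Q * t} \<le> card {..T div d}"
    by (intro card_inj_on_le) auto
  then show ?thesis by simp
qed

text \<open>Telescoping: \<open>1 / (n + 1)\<^sup>2 \<le> 1 / n - 1 / (n + 1)\<close>.\<close>

lemma sum_inverse_squares_tail_le:
  assumes "z \<ge> 1"
  shows "(\<Sum>d = Suc z..N. 1 / (real d)\<^sup>2) \<le> 1 / real z"
proof (cases "z \<le> N")
  case True
  then have "(\<Sum>d = Suc z..N. 1 / (real d)\<^sup>2) \<le> 1 / real z - 1 / real N"
  proof (induction N rule: dec_induct)
    case (step n)
    have "1 / (real (Suc n))\<^sup>2 \<le> 1 / (real n * real (Suc n))"
      using step assms by (intro divide_left_mono) (auto simp: power2_eq_square)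
    also have "\<dots> = 1 / real n - 1 / real (Suc n)"
      using step assms by (simp add: field_simps)
    finally show ?case using step by simp
  qed simp
  moreover have "1 / real N \<ge> 0" by simp
  ultimately show ?thesis by linarith
qed auto

text \<open>Any bound of smaller order than \<open>N\<close> serves for the error term of the averaging argument; this one has a
  direct induction through \<open>1 / (n + 1) \<le> 2 (\<surd>(n + 1) - \<surd>n)\<close>.\<close>

lemma sum_inverse_le_sqrt: "(\<Sum>d = 1..N. 1 / real d) \<le> 2 * sqrt (real N)"
proof (induction N)
  case (Suc n)
  have "sqrt (real n) \<le> sqrt (real (Suc n))" by simp
  have "1 + 2 * (sqrt (real n) * sqrt (real (Suc n))) \<le> 2 * real (Suc n)"
    using arith_geo_mean_sqrt[of "real n" "real (Suc n)"]
    by (simp add: real_sqrt_mult)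
  then have "1 \<le> 2 * (sqrt (real (Suc n)) - sqrt (real n)) * sqrt (real (Suc n))"
    by (simp add: algebra_simps)
  also have "\<dots> \<le> 2 * (sqrt (real (Suc n)) - sqrt (real n)) * real (Suc n)"
    by (intro mult_left_mono) (auto intro: real_le_lsqrt simp: power2_eq_square)
  finally have "1 / real (Suc n) \<le> 2 * (sqrt (real (Suc n)) - sqrt (real n))"
    by (simp add: divide_le_eq del: of_nat_Suc)
  with Suc show ?case by simp
qed simp

text \<open>Exchange the sums over \<open>t\<close> and \<open>d\<close>. Every divisor of a term is coprime to \<open>Q\<close>, and hence exceeds \<open>z\<close>
  unless it is 1. A given \<open>d\<close> divides at most \<open>T / d + 1\<close> of the terms and contributes \<open>1 / d\<close>
  each time: the main parts \<open>T / d\<^sup>2\<close> add up to at most \<open>T / z\<close>, the rounding errors \<open>1 / d\<close> to the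
  square root.\<close>

lemma sum_aliquot_ratio_progression_le:
  fixes c Q T z N :: nat
  assumes "z \<ge> 1" and "fact z dvd Q" and "coprime c Q" and "c \<ge> 1"
    and N: "\<And>t. t < T \<Longrightarrow> c + Q * t \<le> N"
  shows "(\<Sum>t<T. aliquot_ratio (c + Q * t)) \<le> real T / real z + 2 * sqrt (real N)"
proof -
  have cop: "coprime d Q" if "d dvd c + Q * t" for d t
  proof (rule coprimeI)
    fix e assume e: "e dvd d" "e dvd Q"
    then have "e dvd c" using that
      by (metis dvd_add_left_iff dvd_mult2 dvd_trans)
    with e assms(3) show "is_unit e" by (auto dest: coprime_common_divisor)
  qed
  have large: "z < d" if "d dvd c + Q * t" "1 < d" for d t
  proof (rule ccontr)
    assume "\<not> z < d"
    then have "d dvd Q" using that assms(2) by (meson dvd_fact dvd_trans less_imp_le not_less)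
    then show False using cop[OF that(1)] that(2) by auto
  qed
  have "aliquot_ratio (c + Q * t) =
      (\<Sum>d = Suc z..N. if d dvd c + Q * t then 1 / real d else 0)" if "t < T" for t
  proof -
    have "{d. d dvd c + Q * t \<and> 1 < d} = {d \<in> {Suc z..N}. d dvd c + Q * t}"
    proof (intro equalityI subsetI)
      fix d assume d: "d \<in> {d. d dvd c + Q * t \<and> 1 < d}"
      then have "d \<le> c + Q * t" using assms by (intro dvd_imp_le) auto
      then show "d \<in> {d \<in> {Suc z..N}. d dvd c + Q * t}"
        using d large[of d t] N[OF that] by auto
    qed (use assms in auto)
    then show ?thesis
      unfolding aliquot_ratio_def by (simp only: sum.inter_filter finite_atLeastAtMost)
  qed
  then have "(\<Sum>t<T. aliquot_ratio (c + Q * t)) =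
      (\<Sum>t<T. \<Sum>d = Suc z..N. if d dvd c + Q * t then 1 / real d else 0)"
    by simp
  also have "\<dots> = (\<Sum>d = Suc z..N. \<Sum>t<T. if d dvd c + Q * t then 1 / real d else 0)"
    by (rule sum.swap)
  also have "\<dots> \<le> (\<Sum>d = Suc z..N. real T * (1 / (real d)\<^sup>2) + 1 / real d)"
  proof (rule sum_mono)
    fix d assume d: "d \<in> {Suc z..N}"
    have "(\<Sum>t<T. if d dvd c + Q * t then 1 / real d else 0)
        = real (card {t. t < T \<and> d dvd c + Q * t}) * (1 / real d)"
      by (subst sum.inter_filter[symmetric]) auto
    also have "\<dots> \<le> (real T / real d + 1) * (1 / real d)"
    proof (intro mult_right_mono)
      show "real (card {t. t < T \<and> d dvd c + Q * t}) \<le> real T / real d + 1"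
      proof (cases "coprime d Q")
        case True
        then have "real (card {t. t < T \<and> d dvd c + Q * t}) \<le> real (T div d + 1)"
          using d by (subst of_nat_le_iff, intro card_dvd_progression_le) auto
        also have "\<dots> \<le> real T / real d + 1"
          using of_nat_div_le_of_nat[of T d, where ?'a = real] by simp
        finally show ?thesis .
      next
        case False
        then have "{t. t < T \<and> d dvd c + Q * t} = {}" using cop by auto
        then show ?thesis by (simp only: card.empty) simp
      qed
    qed simp
    also have "\<dots> = real T * (1 / (real d)\<^sup>2) + 1 / real d"
      by (simp add: add_divide_distrib power2_eq_square)
    finally show "(\<Sum>t<T. if d dvd c + Q * t then 1 / real d else 0)
        \<le> real T * (1 / (real d)\<^sup>2) + 1 / real d" .
  qed
  also have "\<dots> = real T * (\<Sum>d = Suc z..N. 1 / (real d)\<^sup>2) + (\<Sum>d = Suc z..N. 1 / real d)"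
    by (simp add: sum.distrib sum_distrib_left)
  also have "\<dots> \<le> real T * (1 / real z) + (\<Sum>d = 1..N. 1 / real d)"
    using sum_inverse_squares_tail_le[OF assms(1), of N]
    by (intro add_mono mult_left_mono sum_mono2) auto
  also have "\<dots> \<le> real T / real z + 2 * sqrt (real N)"
    using sum_inverse_le_sqrt[of N] by simp
  finally show ?thesis .
qed

text \<open>If every \<open>t\<close> failed at some \<open>a \<in> A\<close>, the ratios over \<open>A\<close> would add up to at least 1 for each \<open>t\<close>.
  Summed over \<open>t < T\<close> they would reach \<open>T\<close>, whereas the averaging bound gives
  at most \<open>card A * T / z \<le> T / 2\<close> plus an error of order \<open>\<surd>T\<close>.\<close>

lemma exists_simultaneously_deficient:
  fixes r Q z :: nat and A :: "nat set"
  assumes "finite A" and "A \<noteq> {}" and "2 * card A \<le> z" and "fact z dvd Q"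
    and "r \<ge> 1" and cop: "\<And>a. a \<in> A \<Longrightarrow> coprime (r + a) Q"
  shows "\<exists>t. \<forall>a\<in>A. deficient (r + a + Q * t)"
proof (rule ccontr)
  assume none: "\<nexists>t. \<forall>a\<in>A. deficient (r + a + Q * t)"
  define k where "k = card A"
  define C where "C = r + Max A + Q"
  \<comment> \<open>All terms with \<open>t < T\<close> are at most \<open>C * T = (C * s)\<^sup>2\<close>, so the error is at most \<open>2 * k * C * s\<close>;
    the choice of \<open>s\<close> puts it below \<open>T / 2 = C * s\<^sup>2 / 2\<close>.\<close>
  define s where "s = 4 * k + 1"
  define T where "T = C * s\<^sup>2"
  have k: "k \<ge> 1" "2 * k \<le> z"
    using assms by (auto simp: k_def Suc_le_eq card_gt_0_iff)
  have C: "C \<ge> 1" using assms by (simp add: C_def)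
  have T: "T \<ge> 1" using C by (simp add: T_def s_def)
  have bound: "r + a + Q * t \<le> C * T" if "a \<in> A" "t < T" for a t
  proof -
    have "r + a \<le> (r + Max A) * T"
      using T Max_ge[OF assms(1) that(1)]
      by (metis add_left_mono le_trans mult.right_neutral mult_le_mono2)
    moreover have "Q * t \<le> Q * T" using that by (intro mult_le_mono2) auto
    ultimately show ?thesis unfolding C_def add_mult_distrib by linarith
  qed
  have "1 \<le> (\<Sum>a\<in>A. aliquot_ratio (r + a + Q * t))" for t
  proof -
    obtain a where a: "a \<in> A" "\<not> deficient (r + a + Q * t)" using none by blast
    then have "1 \<le> aliquot_ratio (r + a + Q * t)"
      using deficient_iff_aliquot_ratio[of "r + a + Q * t"] assms by simp
    also have "\<dots> \<le> (\<Sum>a\<in>A. aliquot_ratio (r + a + Q * t))"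
      using a assms by (intro member_le_sum) (auto simp: aliquot_ratio_def intro: sum_nonneg)
    finally show ?thesis .
  qed
  then have "(\<Sum>t<T. 1) \<le> (\<Sum>t<T. \<Sum>a\<in>A. aliquot_ratio (r + a + Q * t))"
    by (rule sum_mono)
  also have "\<dots> = (\<Sum>a\<in>A. \<Sum>t<T. aliquot_ratio (r + a + Q * t))"
    by (rule sum.swap)
  also have "\<dots> \<le> (\<Sum>a\<in>A. real T / real z + 2 * sqrt (real (C * T)))"
    using assms k bound by (intro sum_mono sum_aliquot_ratio_progression_le) auto
  also have "\<dots> = real k * (real T / real z) + real k * (2 * sqrt (real (C * T)))"
    by (simp add: k_def algebra_simps)
  also have "sqrt (real (C * T)) = real C * real s"
    by (simp add: T_def real_sqrt_mult power2_eq_square)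
  also have "real k * (real T / real z) \<le> real T / 2"
  proof -
    have "real (2 * k) * real T \<le> real z * real T"
      using k by (intro mult_right_mono) auto
    then show ?thesis using k by (simp add: field_simps)
  qed
  also have "real k * (2 * (real C * real s)) = (4 * real k) * (real C * real s) / 2"
    by simp
  also have "\<dots> < real s * (real C * real s) / 2"
    using C by (intro divide_strict_right_mono mult_strict_right_mono) (auto simp: s_def)
  also have "\<dots> = real T / 2"
    by (simp add: T_def power2_eq_square)
  finally show False by simp
qed

lemma exists_deficient_progression:
  fixes K M X :: nat
  shows "\<exists>P x. P \<ge> M \<and> P > 0 \<and> x \<ge> X \<and> (\<forall>i\<le>Suc K. deficient (x + i * P)) \<and>
    (\<forall>b<Suc K * P. \<not> P dvd b \<longrightarrow> \<not> deficient (x + b))"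
proof -
  \<comment> \<open>The first summand is for the averaging over \<open>K + 2\<close> offsets, the second for \<open>P \<ge> M\<close>.\<close>
  define z where "z = 2 * (K + 2) + M"
  define P :: nat where "P = fact z"
  have "z \<le> P" unfolding P_def by (rule fact_ge_self)
  then have P: "P \<ge> M" "P > 0" by (auto simp: z_def P_def)
  obtain r Q where rQ: "r \<ge> X" "r \<ge> 1" "Q > 0" "P dvd Q"
    "\<And>a. a \<le> Suc K * P \<Longrightarrow> P dvd a \<Longrightarrow> coprime (r + a) Q"
    "\<And>b t. b < Suc K * P \<Longrightarrow> \<not> P dvd b \<Longrightarrow> \<not> deficient (r + b + Q * t)"
    using exists_residue_class_pattern[OF P(2), of "Suc K * P" X] by auto
  define A where "A = (\<lambda>i. i * P) ` {..Suc K}"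
  have "card A \<le> K + 2"
    unfolding A_def using card_image_le[of "{..Suc K}" "\<lambda>i. i * P"] by simp
  then have "\<exists>t. \<forall>a\<in>A. deficient (r + a + Q * t)"
    using rQ by (intro exists_simultaneously_deficient[where z = z])
      (auto simp: A_def z_def P_def simp del: mult_Suc)
  then obtain t where t: "\<And>a. a \<in> A \<Longrightarrow> deficient (r + a + Q * t)" by blast
  have swap: "r + Q * t + y = r + y + Q * t" for y by simp
  show ?thesis
    using P rQ t
    by (intro exI[of _ P] exI[of _ "r + Q * t"]) (auto simp: A_def swap simp del: mult_Suc)
qed

section \<open>Transfer to the enumeration\<close>

lemma enumerate_consecutive:
  fixes S :: "nat set"
  assumes "infinite S" and "enumerate S j = x" and "x < y" and "y \<in> S"
    and "\<And>w. x < w \<Longrightarrow> w < y \<Longrightarrow> w \<notin> S"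
  shows "enumerate S (Suc j) = y"
  unfolding enumerate_Suc''[OF assms(1)] using assms
  by (intro Least_equality) (auto simp: not_less[symmetric])

text \<open>Between two neighbouring terms of the progression no offset is a multiple of \<open>P\<close>, so no
  deficient number intervenes and the enumeration runs through the progression term by term. The freedom to
  start beyond \<open>J\<close> is what a limit superior asks for.\<close>

lemma exists_deficient_seq_progression:
  fixes K M J :: nat
  shows "\<exists>j\<ge>J. \<exists>P\<ge>M. \<exists>x. \<forall>i\<le>Suc K. deficient_seq (j + i) = x + i * P"
proof -
  define S where "S = {n. deficient n}"
  have S: "infinite S" by (simp add: S_def infinite_deficient)
  obtain P x where Px: "P \<ge> M" "P > 0" "x \<ge> enumerate S J"
    "\<And>i. i \<le> Suc K \<Longrightarrow> deficient (x + i * P)"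
    "\<And>b. b < Suc K * P \<Longrightarrow> \<not> P dvd b \<Longrightarrow> \<not> deficient (x + b)"
    using exists_deficient_progression[of M "enumerate S J" K] by metis
  have "x \<in> S" using Px(4)[of 0] by (simp add: S_def)
  then obtain j where j: "enumerate S j = x" using enumerate_Ex[OF S] by blast
  then have "J \<le> j" using Px(3) S by (metis enumerate_mono_le_iff)
  have "enumerate S (j + i) = x + i * P" if "i \<le> Suc K" for i
    using that
  proof (induction i)
    case (Suc i)
    have "enumerate S (Suc (j + i)) = x + Suc i * P"
    proof (rule enumerate_consecutive[OF S])
      show "enumerate S (j + i) = x + i * P" using Suc by simp
      show "x + i * P < x + Suc i * P" using Px(2) by simp
      show "x + Suc i * P \<in> S" using Px(4)[of "Suc i"] Suc.prems by (simp add: S_def del: mult_Suc)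
    next
      fix w assume w: "x + i * P < w" "w < x + Suc i * P"
      define b where "b = w - x"
      have b: "w = x + b" "i * P < b" "b < Suc i * P" using w by (auto simp: b_def)
      have "\<not> P dvd b"
      proof
        assume "P dvd b"
        then obtain e where "b = e * P" by (metis dvdE mult.commute)
        with b have "i < e" "e < Suc i" by (metis mult_less_cancel2)+
        then show False by simp
      qed
      moreover have "Suc i * P \<le> Suc K * P"
        using Suc.prems by (intro mult_le_mono1) auto
      then have "b < Suc K * P" using b(3) by linarith
      ultimately show "w \<notin> S" using Px(5) b(1) by (simp add: S_def)
    qed
    then show ?case by simp
  qed (simp add: j)
  then have "\<forall>i\<le>Suc K. deficient_seq (Suc j + i) = x + i * P"
    by (simp add: deficient_seq_def S_def)
  then show ?thesis using le_SucI[OF \<open>J \<le> j\<close>] Px(1) by blast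
qed

theorem corollary1p15:
  fixes K :: nat
  assumes "K \<ge> 1"
  shows "limsup (\<lambda>j. INF k\<in>{0..K}.
           ereal (real (deficient_seq (j + k + 1)) - real (deficient_seq (j + k)))) = \<infinity>"
proof -
  define f where "f j = (INF k\<in>{0..K}.
      ereal (real (deficient_seq (j + k + 1)) - real (deficient_seq (j + k))))" for j
  have *: "\<exists>j\<ge>J. ereal (real M) \<le> f j" for J M
  proof -
    obtain j P x where j: "j \<ge> J" "P \<ge> M"
      and eq: "\<forall>i\<le>Suc K. deficient_seq (j + i) = x + i * P"
      using exists_deficient_seq_progression[of J M K] by blast
    have "ereal (real M) \<le> f j"
      unfolding f_def
    proof (rule INF_greatest)
      fix k assume "k \<in> {0..K}"
      then have "deficient_seq (j + k + 1) = x + Suc k * P" "deficient_seq (j + k) = x + k * P"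
        using eq[rule_format, of "Suc k"] eq[rule_format, of k] by simp_all
      then show "ereal (real M)
          \<le> ereal (real (deficient_seq (j + k + 1)) - real (deficient_seq (j + k)))"
        using j(2) by (simp add: algebra_simps)
    qed
    with j(1) show ?thesis by blast
  qed
  have "(SUP j\<in>{J..}. f j) = \<infinity>" for J
  proof (rule ereal_top)
    fix B :: real
    obtain M :: nat where "B \<le> real M" using real_arch_simple by blast
    then have "ereal B \<le> ereal (real M)" by simp
    moreover obtain j where j: "j \<ge> J" "ereal (real M) \<le> f j" using * by blast
    ultimately have "ereal B \<le> f j" by (meson order_trans)
    then show "ereal B \<le> (SUP j\<in>{J..}. f j)"
      using j(1) by (intro SUP_upper2[of j]) auto
  qed
  then have "limsup f = \<infinity>"
    by (simp add: limsup_INF_SUP)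
  then show ?thesis
    by (simp add: f_def[abs_def])
qed

end
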